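(* Let $n\ge1$ and let $\varphi:\mathbb{R}^n\to\mathbb{R}^n$ be a $C^1$ diffeomorphism with $\det D\varphi(x)>0$ for all $x\in\mathbb{R}^n$. For a probability density $\rho$ on $\mathbb{R}^n$ let $\varphi_*\rho$ denote the density of the push-forward under $\varphi$ of the probability measure $\rho\,dx$. Then $$I[\varphi_*\rho]=I[\rho]\quad\text{for every probability density }\rho\text{ on }\mathbb{R}^n\text{ such that }\rho\log\rho\text{ is integrable}$$ if and only if $\det D\varphi(x)=1$ for every $x\in\mathbb{R}^n$.
   Context: For a probability density $\rho$ on $\mathbb{R}^n$, the information (Shannon/Gibbs) entropy is $I[\rho]=-\int_{\mathbb{R}^n}\rho\log\rho\,dx$, with the convention $0\log0=0$. The equality $I[\varphi_*\rho]=I[\rho]$ includes the assertion that $I[\varphi_*\rho]$ is well defined (as a Lebesgue integral) and finite. *)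

theory Defs
  imports "HOL-Analysis.Analysis"
begin

definition C1_map :: "(real ^ 'n \<Rightarrow> real ^ 'n) \<Rightarrow> bool" where
  "C1_map f \<longleftrightarrow>
     (\<forall>x. f differentiable (at x)) \<and> continuous_on UNIV (\<lambda>x. jacobian f (at x))"

definition C1_diffeomorphism :: "(real ^ 'n \<Rightarrow> real ^ 'n) \<Rightarrow> bool" where
  "C1_diffeomorphism f \<longleftrightarrow> bij f \<and> C1_map f \<and> C1_map (inv f)"

definition prob_density :: "(real ^ 'n \<Rightarrow> real) \<Rightarrow> bool" where
  "prob_density \<rho> \<longleftrightarrow>
     (\<forall>x. 0 \<le> \<rho> x) \<and> integrable lebesgue \<rho> \<and> integral\<^sup>L lebesgue \<rho> = 1"

text \<open>Since \<open>ln 0 = 0\<close> in HOL, the integrand satisfies the convention \<open>0 log 0 = 0\<close>.\<close>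

definition rho_log_rho :: "(real ^ 'n \<Rightarrow> real) \<Rightarrow> real ^ 'n \<Rightarrow> real" where
  "rho_log_rho \<rho> x = \<rho> x * ln (\<rho> x)"

text \<open>Meaningful as an entropy only when \<open>rho_log_rho \<rho>\<close> is integrable:
  the Bochner integral of a non-integrable function is \<open>0\<close> by convention.\<close>

definition info_entropy :: "(real ^ 'n \<Rightarrow> real) \<Rightarrow> real" where
  "info_entropy \<rho> = - integral\<^sup>L lebesgue (rho_log_rho \<rho>)"

text \<open>A density is determined only up to a null set; the Radon-Nikodym derivative
  selects one representative. The lemma after the definition shows that any other
  density of the same push-forward measure agrees with it almost everywhere.\<close>

definition pushforward_density ::
    "(real ^ 'n \<Rightarrow> real ^ 'n) \<Rightarrow> (real ^ 'n \<Rightarrow> real) \<Rightarrow> real ^ 'n \<Rightarrow> real" where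
  "pushforward_density \<phi> \<rho> y =
     enn2real (RN_deriv lebesgue (distr (density lebesgue \<rho>) lebesgue \<phi>) y)"

lemma pushforward_density_unique:
  fixes \<phi> :: "real ^ 'n \<Rightarrow> real ^ 'n" and \<rho> \<sigma> :: "real ^ 'n \<Rightarrow> real"
  assumes \<sigma>: "\<sigma> \<in> borel_measurable lebesgue" "\<And>y. 0 \<le> \<sigma> y"
    and push: "distr (density lebesgue \<rho>) lebesgue \<phi> = density lebesgue \<sigma>"
  shows "AE y in lebesgue. pushforward_density \<phi> \<rho> y = \<sigma> y"
proof -
  interpret sigma_finite_measure "lebesgue :: (real ^ 'n) measure"
  proof
    obtain A :: "(real ^ 'n) set set" where A: "countable A" "A \<subseteq> sets lborel"
        "\<Union>A = space lborel" "\<forall>a\<in>A. emeasure lborel a \<noteq> \<infinity>"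
      using sigma_finite_measure.sigma_finite_countable[OF sigma_finite_lborel] by blast
    show "\<exists>A :: (real ^ 'n) set set. countable A \<and> A \<subseteq> sets lebesgue \<and> \<Union>A = space lebesgue \<and>
        (\<forall>a\<in>A. emeasure lebesgue a \<noteq> \<infinity>)"
    proof (intro exI conjI ballI)
      show "A \<subseteq> sets lebesgue" using A(2) by (auto simp del: sets_lborel)
      show "emeasure lebesgue a \<noteq> \<infinity>" if "a \<in> A" for a
        using A(2,4) that by (metis emeasure_completion main_part subsetD sets_completionI_sets)
    qed (use A in auto)
  qed
  have "AE y in lebesgue. ennreal (\<sigma> y) =
      RN_deriv lebesgue (distr (density lebesgue \<rho>) lebesgue \<phi>) y"
    by (rule RN_deriv_unique) (use \<sigma> push in auto)
  then show ?thesis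
  proof eventually_elim
    case (elim y)
    then show ?case
      by (metis \<sigma>(2) enn2real_ennreal pushforward_density_def)
  qed
qed

end

theory Submission
  imports Defs
begin

text \<open>Write \<open>J = det D\<phi>\<close>. The push-forward of \<open>\<rho>\<close> has density \<open>(\<rho> / J) \<circ> \<phi>\<^sup>-\<^sup>1\<close>, so a change of
  variables turns the integral of its \<open>\<rho> log \<rho>\<close> into that of \<open>\<rho> log \<rho> - \<rho> log J\<close>. The entropy is
  therefore preserved if \<open>J = 1\<close>. Conversely, if \<open>log J\<close> is nonzero at some point, it has constant sign
  on a ball around it by continuity, and the uniform density \<open>\<rho>\<close> on that ball makes the integral of
  \<open>\<rho> log J\<close> nonzero.\<close>

section \<open>Change of variables for an arbitrary finite index type\<close>

text \<open>The library's change-of-variables theorem needs a well-ordered index type, which the index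
  type of the theorem need not be: it is therefore applied to a well-ordered copy of that type.\<close>

typedef ('a :: finite) ranked = "UNIV :: 'a set" by blast

lemma bij_Rep_ranked: "bij Rep_ranked"
  by (metis Abs_ranked_inverse Rep_ranked_inverse UNIV_I bijI')

instance ranked :: (finite) finite
proof
  show "finite (UNIV :: 'a ranked set)"
    using bij_Rep_ranked by (metis bij_betw_finite finite)
qed

instantiation ranked :: (finite) wellorder
begin

definition "a < b \<longleftrightarrow> to_nat (Rep_ranked a) < to_nat (Rep_ranked b)"
definition "a \<le> b \<longleftrightarrow> to_nat (Rep_ranked a) \<le> to_nat (Rep_ranked b)"

instance
proof
  fix P :: "'a ranked \<Rightarrow> bool" and a
  assume step: "\<And>x. (\<And>y. y < x \<Longrightarrow> P y) \<Longrightarrow> P x"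
  show "P a"
    by (induction a rule: measure_induct_rule[of "\<lambda>a. to_nat (Rep_ranked a)"])
       (metis step less_ranked_def)
qed (auto simp: less_ranked_def less_eq_ranked_def Rep_ranked_inject)

end

section \<open>Relabelling coordinates: effect on determinants and on Lebesgue measure\<close>

definition reindex :: "('m \<Rightarrow> 'n) \<Rightarrow> real ^ 'n \<Rightarrow> real ^ 'm" where
  "reindex e x = (\<chi> i. x $ e i)"

lemma reindex_nth [simp]: "reindex e x $ i = x $ e i"
  by (simp add: reindex_def)

lemma linear_reindex: "linear (reindex e)"
  by (rule linearI) (auto simp: vec_eq_iff)

lemma borel_measurable_reindex: "reindex e \<in> borel_measurable lborel"
  using linear_reindex[of e] by (simp add: borel_measurable_continuous_onI linear_continuous_on
      linear_conv_bounded_linear)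

lemma reindex_inv:
  assumes "bij e"
  shows "reindex e (reindex (inv e) x) = x" "reindex (inv e) (reindex e y) = y"
  using assms by (auto simp: vec_eq_iff bij_is_inj bij_is_surj surj_f_inv_f)

lemma bij_reindex:
  assumes "bij e"
  shows "bij (reindex e)"
  by (metis assms bijI' reindex_inv)

text \<open>Conjugation with \<open>e\<close> is a sign-preserving bijection between the
  permutations of the two index types, so the two Leibniz expansions agree term by term.\<close>

lemma det_reindex:
  fixes A :: "'a :: comm_ring_1 ^ 'n ^ 'n" and e :: "'m :: finite \<Rightarrow> 'n"
  assumes e: "bij e"
  shows "det (\<chi> i j. A $ e i $ e j) = det A"
proof -
  have inj: "inj e" using e by (rule bij_is_inj)
  let ?F = "map_permutation UNIV e"
  have bij: "bij_betw ?F {p. p permutes UNIV} {p. p permutes UNIV}"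
  proof (rule bij_betw_byWitness[where f' = "map_permutation UNIV (inv e)"])
    show "\<forall>p\<in>{p. p permutes UNIV}. map_permutation UNIV (inv e) (?F p) = p"
      using e by (auto intro!: map_permutation_compose_inv simp: inj)
    show "\<forall>p\<in>{p. p permutes UNIV}. ?F (map_permutation UNIV (inv e) p) = p"
      using e by (auto intro!: map_permutation_compose_inv bij_imp_bij_inv
          simp: bij_is_surj surj_f_inv_f)
  qed (use e in \<open>auto intro!: map_permutation_permutes bij_imp_bij_inv\<close>)
  have "det A = (\<Sum>p | p permutes (UNIV :: 'm set).
      of_int (sign (?F p)) * (\<Prod>i\<in>UNIV. A $ i $ ?F p i))"
    unfolding det_def by (rule sum.reindex_bij_betw[OF bij, symmetric])
  also have "\<dots> = (\<Sum>p | p permutes (UNIV :: 'm set).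
      of_int (sign p) * (\<Prod>i\<in>UNIV. A $ e i $ e (p i)))"
  proof (intro sum.cong refl, clarify)
    fix p :: "'m \<Rightarrow> 'm" assume p: "p permutes UNIV"
    \<comment> \<open>Running over the rows as \<open>e i\<close> exposes \<open>?F p (e i)\<close>,
      which is \<open>e (p i)\<close> because \<open>?F p\<close> is the conjugate of
      \<open>p\<close> by \<open>e\<close>.\<close>
    have "(\<Prod>i\<in>UNIV. A $ i $ ?F p i) = (\<Prod>i\<in>UNIV. A $ e i $ ?F p (e i))"
      by (rule prod.reindex_bij_betw[OF e, symmetric])
    then show "of_int (sign (?F p)) * (\<Prod>i\<in>UNIV. A $ i $ ?F p i) =
        of_int (sign p) * (\<Prod>i\<in>UNIV. A $ e i $ e (p i))"
      using p by (simp add: sign_map_permutation inj map_permutation_apply)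
  qed
  finally show ?thesis
    by (simp add: det_def)
qed

text \<open>Volumes of boxes are products over \<open>Basis\<close>; as products over indices they
  can be rearranged along a bijection of index types.\<close>

lemma prod_Basis_cart:
  fixes x :: "real ^ 'n"
  shows "(\<Prod>b\<in>Basis. x \<bullet> b) = (\<Prod>i\<in>UNIV. x $ i)"
proof -
  have "bij_betw (\<lambda>i. axis i (1 :: real)) (UNIV :: 'n set) Basis"
    by (auto simp: bij_betw_def inj_on_def axis_eq_axis Basis_vec_def)
  from prod.reindex_bij_betw[OF this, of "\<lambda>b. x \<bullet> b"] show ?thesis
    by (simp add: inner_axis)
qed

text \<open>A Borel measure with the right values on boxes is \<open>lborel\<close>. The preimage of
  a box is the box with relabelled sides, and its volume has the same factors in another
  order.\<close>

lemma lborel_distr_reindex: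
  fixes e :: "'m :: finite \<Rightarrow> 'n :: finite"
  assumes e: "bij e"
  shows "distr lborel borel (reindex e) = lborel"
proof (rule lborel_eqI[symmetric])
  fix l u :: "real ^ 'm"
  assume lu: "\<And>b. b \<in> Basis \<Longrightarrow> l \<bullet> b \<le> u \<bullet> b"
  have le: "l $ i \<le> u $ i" for i
    using lu[of "axis i 1"] by (simp add: inner_axis axis_in_Basis_iff)
  have "reindex e -` box l u = box (reindex (inv e) l) (reindex (inv e) u)"
    using e by (auto simp: mem_box_cart) (metis bij_inv_eq_iff)+
  then have "emeasure (distr lborel borel (reindex e)) (box l u) =
      emeasure lborel (box (reindex (inv e) l) (reindex (inv e) u))"
    using borel_measurable_reindex[of e] by (simp add: emeasure_distr)
  also have "\<dots> = (\<Prod>b\<in>Basis. (reindex (inv e) u - reindex (inv e) l) \<bullet> b)"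
    by (rule emeasure_lborel_box) (auto simp: Basis_vec_def inner_axis le)
  also have "(\<Prod>b\<in>Basis. (reindex (inv e) u - reindex (inv e) l) \<bullet> b) =
      (\<Prod>i\<in>UNIV. u $ inv e i - l $ inv e i)"
    by (subst prod_Basis_cart) simp
  also have "\<dots> = (\<Prod>i\<in>UNIV. u $ i - l $ i)"
    using e by (intro prod.reindex_bij_betw bij_imp_bij_inv)
  also have "\<dots> = (\<Prod>b\<in>Basis. (u - l) \<bullet> b)"
    by (subst prod_Basis_cart) simp
  finally show "emeasure (distr lborel borel (reindex e)) (box l u) =
      ennreal (\<Prod>b\<in>Basis. (u - l) \<bullet> b)" .
qed auto

text \<open>Borel measurability extends to the completions because preimages of null sets are null,
  which the invariance of \<open>lborel\<close> guarantees; the invariance then passes to the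
  completed measure.\<close>

lemma
  fixes e :: "'m :: finite \<Rightarrow> 'n :: finite"
  assumes e: "bij e"
  shows measurable_lebesgue_reindex: "reindex e \<in> lebesgue \<rightarrow>\<^sub>M lebesgue"
    and lebesgue_distr_reindex: "distr lebesgue lebesgue (reindex e) = lebesgue"
proof -
  have *: "reindex e \<in> lebesgue \<rightarrow>\<^sub>M lborel"
    using measurable_completion[OF borel_measurable_reindex] by simp
  have "distr lborel lborel (reindex e) = distr lborel borel (reindex e)"
    by (rule distr_cong) auto
  with * lborel_distr_reindex[OF e] have eq: "distr lebesgue lborel (reindex e) = lborel"
    using distr_completion[of "reindex e" lborel lborel] borel_measurable_reindex[of e] by simp
  show "reindex e \<in> lebesgue \<rightarrow>\<^sub>M lebesgue"
    using * by (rule completion.measurable_completion2) (simp add: eq)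
  show "distr lebesgue lebesgue (reindex e) = lebesgue"
    using completion.completion_distr_eq[OF *] by (simp add: eq)
qed

section \<open>Change of variables for real-valued Lebesgue integrals\<close>

lemma
  fixes f :: "real ^ 'm :: {finite,wellorder} \<Rightarrow> real" and g :: "real ^ 'm :: _ \<Rightarrow> real ^ 'm :: _"
  assumes der: "\<And>x. (g has_derivative g' x) (at x)" and bij: "bij g"
  shows integrable_change_of_variables_wellorder:
      "integrable lebesgue (\<lambda>x. \<bar>det (matrix (g' x))\<bar> * f (g x)) \<longleftrightarrow> integrable lebesgue f"
    and integral_change_of_variables_wellorder: "integrable lebesgue f \<Longrightarrow>
      (\<integral>x. \<bar>det (matrix (g' x))\<bar> * f (g x) \<partial>lebesgue) = (\<integral>x. f x \<partial>lebesgue)"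
proof -
  \<comment> \<open>The change-of-variables theorem applied below concerns vector-valued integrands
    and the gauge integral. Hence \<open>f\<close> is encoded with values in
    \<open>real ^ 1\<close>, and the results are translated back to Lebesgue integrals of real
    functions.\<close>
  define h where "h = (\<lambda>x. vec (f x) :: real ^ 1)"
  define J where "J = (\<lambda>x. \<bar>det (matrix (g' x))\<bar>)"
  have vec: "integrable lebesgue (\<lambda>x. vec (u x) :: real ^ 1) \<longleftrightarrow> integrable lebesgue u"
    for u :: "real ^ 'm :: _ \<Rightarrow> real"
  proof
    assume "integrable lebesgue (\<lambda>x. vec (u x) :: real ^ 1)"
    from integrable_bounded_linear[OF bounded_linear_vec_nth this, of 1]
    show "integrable lebesgue u" by simp
  next
    assume "integrable lebesgue u"
    moreover have "bounded_linear (vec :: real \<Rightarrow> real ^ 1)"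
      by (simp add: linear_conv_bounded_linear[symmetric])
    ultimately show "integrable lebesgue (\<lambda>x. vec (u x) :: real ^ 1)"
      by (rule integrable_bounded_linear[rotated])
  qed
  have UN: "u absolutely_integrable_on UNIV \<longleftrightarrow> integrable lebesgue u"
     for u :: "real ^ 'm :: _ \<Rightarrow> real ^ 1"
    by (simp add: set_integrable_def)
  have Jh: "J x *\<^sub>R h (g x) = vec (J x * f (g x))" for x
    by (simp add: h_def vec_eq_iff)
  have cv: "(\<lambda>x. J x *\<^sub>R h (g x)) absolutely_integrable_on UNIV \<and>
      integral UNIV (\<lambda>x. J x *\<^sub>R h (g x)) = b \<longleftrightarrow>
      h absolutely_integrable_on UNIV \<and> integral UNIV h = b" for b
    using has_absolute_integral_change_of_variables[of UNIV g g' h b] der bij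
    by (simp add: J_def bij_is_inj bij_is_surj)
  \<comment> \<open>Since \<open>b\<close> is arbitrary in \<open>cv\<close>, choosing it as the
    value of the integral on either side isolates the integrability claim.\<close>
  have "(\<lambda>x. J x *\<^sub>R h (g x)) absolutely_integrable_on UNIV \<longleftrightarrow> h absolutely_integrable_on UNIV"
    using cv by metis
  then have iff': "integrable lebesgue (\<lambda>x. J x * f (g x)) \<longleftrightarrow> integrable lebesgue f"
    unfolding UN Jh vec by (simp add: h_def vec)
  then show iff: "integrable lebesgue (\<lambda>x. \<bar>det (matrix (g' x))\<bar> * f (g x)) \<longleftrightarrow> integrable lebesgue f"
    by (simp add: J_def)
  assume f: "integrable lebesgue f"
  have int: "(\<integral>x. u x \<partial>lebesgue) = integral UNIV (\<lambda>x. vec (u x) :: real ^ 1) $ 1"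
    if "integrable lebesgue u" for u :: "real ^ 'm :: _ \<Rightarrow> real"
  proof -
    have *: "integrable lebesgue (\<lambda>x. vec (u x) :: real ^ 1)"
      using that vec by blast
    have "integral UNIV (\<lambda>x. vec (u x) :: real ^ 1) = (\<integral>x. vec (u x) \<partial>lebesgue)"
      using set_lebesgue_integral_eq_integral(2)[of UNIV "\<lambda>x. vec (u x) :: real ^ 1"] * UN
      by (simp add: set_lebesgue_integral_def)
    then show ?thesis
      using integral_bounded_linear[OF bounded_linear_vec_nth *, of 1] by simp
  qed
  have "h absolutely_integrable_on UNIV"
    unfolding UN h_def using f vec by blast
  then have "integral UNIV (\<lambda>x. J x *\<^sub>R h (g x)) = integral UNIV h"
    using cv by blast
  then have "(\<integral>x. J x * f (g x) \<partial>lebesgue) = (\<integral>x. f x \<partial>lebesgue)"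
    unfolding int[OF f] int[OF iff'[THEN iffD2, OF f]] Jh by (simp add: h_def)
  then show "(\<integral>x. \<bar>det (matrix (g' x))\<bar> * f (g x) \<partial>lebesgue) = (\<integral>x. f x \<partial>lebesgue)"
    by (simp add: J_def)
qed

text \<open>Conjugating \<open>g\<close> with the relabelling \<open>?R\<close> and its inverse
  \<open>?S\<close> gives a map \<open>G\<close> on the well-ordered copy. Neither Jacobian
  determinants nor Lebesgue integrals change under relabelling, so the result for \<open>G\<close>
  carries over.\<close>

lemma
  fixes f :: "real ^ 'n \<Rightarrow> real" and g :: "real ^ 'n \<Rightarrow> real ^ 'n"
  assumes der: "\<And>x. (g has_derivative g' x) (at x)" and bij: "bij g"
  shows integrable_change_of_variables:
      "integrable lebesgue (\<lambda>x. \<bar>det (matrix (g' x))\<bar> * f (g x)) \<longleftrightarrow> integrable lebesgue f"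
    and lebesgue_integral_change_of_variables: "integrable lebesgue f \<Longrightarrow>
      (\<integral>x. \<bar>det (matrix (g' x))\<bar> * f (g x) \<partial>lebesgue) = (\<integral>x. f x \<partial>lebesgue)"
proof -
  let ?e = "Rep_ranked :: 'n ranked \<Rightarrow> 'n"
  let ?R = "reindex ?e" and ?S = "reindex (inv ?e)"
  note e = bij_Rep_ranked[where 'a = 'n]
  note e' = bij_imp_bij_inv[OF e]
  have SR [simp]: "?S (?R x) = x" "?R (?S y) = y" for x y
    using reindex_inv[OF e] by auto
  have bl: "bounded_linear ?R" "bounded_linear ?S"
    by (simp_all add: linear_conv_bounded_linear[symmetric] linear_reindex)
  define G where "G = (\<lambda>y. ?R (g (?S y)))"
  define G' where "G' = (\<lambda>y h. ?R (g' (?S y) (?S h)))"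
  have derG: "(G has_derivative G' y) (at y)" for y
    unfolding G_def G'_def
    by (rule bounded_linear.has_derivative[OF bl(1)] has_derivative_compose[OF _ der]
        bounded_linear_imp_has_derivative bl)+
  have bijG: "bij G"
    unfolding G_def using bij_comp[OF bij_comp[OF bij_reindex[OF e'] bij] bij_reindex[OF e]]
    by (simp add: o_def)
  have detG: "det (matrix (G' y)) = det (matrix (g' (?S y)))" for y
  proof -
    \<comment> \<open>Basis vectors go to basis vectors, so the matrix of \<open>G'\<close> is that
      of \<open>g'\<close> with rows and columns relabelled in the same way.\<close>
    have axis: "?S (axis i 1) = axis (?e i) 1" for i
      by (auto simp: vec_eq_iff axis_def bij_is_inj[OF e] surj_f_inv_f[OF bij_is_surj[OF e]])
    have "matrix (G' y) $ i $ j = matrix (g' (?S y)) $ ?e i $ ?e j" for i j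
      by (simp add: matrix_def G'_def axis)
    then have "matrix (G' y) = (\<chi> i j. matrix (g' (?S y)) $ ?e i $ ?e j)"
      by (simp add: vec_eq_iff)
    then show ?thesis
      using det_reindex[OF e] by metis
  qed
  have int: "integrable lebesgue (\<lambda>y. u (?S y)) \<longleftrightarrow> integrable lebesgue u"
    "(\<integral>y. u (?S y) \<partial>lebesgue) = (\<integral>x. u x \<partial>lebesgue)" for u :: "real ^ 'n \<Rightarrow> real"
  proof -
    \<comment> \<open>Transfer along \<open>?S\<close> presupposes that \<open>u\<close> is
      measurable; this is recovered from \<open>u\<close> composed with \<open>?S\<close> by
      composing further with \<open>?R\<close>.\<close>
    have meas: "u \<in> borel_measurable lebesgue" if "(\<lambda>y. u (?S y)) \<in> borel_measurable lebesgue"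
      using measurable_compose[OF measurable_lebesgue_reindex[OF e] that] by simp
    show "integrable lebesgue (\<lambda>y. u (?S y)) \<longleftrightarrow> integrable lebesgue u"
      using integrable_distr_eq[OF measurable_lebesgue_reindex[OF e'], of u]
        integrable_distr[OF measurable_lebesgue_reindex[OF e'], of u] meas
        borel_measurable_integrable
      unfolding lebesgue_distr_reindex[OF e'] by blast
    \<comment> \<open>If \<open>u\<close> is not integrable, neither is its composition with
      \<open>?S\<close>, and both integrals take the default value 0.\<close>
    then show "(\<integral>y. u (?S y) \<partial>lebesgue) = (\<integral>x. u x \<partial>lebesgue)"
      using integral_distr[OF measurable_lebesgue_reindex[OF e'], of u] borel_measurable_integrable
        not_integrable_integral_eq
      unfolding lebesgue_distr_reindex[OF e'] by metis
  qed
  define F where "F = (\<lambda>x. \<bar>det (matrix (g' x))\<bar> * f (g x))"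
  have eq: "(\<lambda>y. \<bar>det (matrix (G' y))\<bar> * f (?S (G y))) = (\<lambda>y. F (?S y))"
    unfolding detG by (simp add: G_def F_def)
  have iff: "integrable lebesgue (\<lambda>y. F (?S y)) \<longleftrightarrow> integrable lebesgue (\<lambda>y. f (?S y))"
    using integrable_change_of_variables_wellorder[OF derG bijG, of "\<lambda>y. f (?S y)"]
    by (simp only: eq)
  have "integrable lebesgue F \<longleftrightarrow> integrable lebesgue f"
    using iff int(1)[of F] int(1)[of f] by blast
  then show "integrable lebesgue (\<lambda>x. \<bar>det (matrix (g' x))\<bar> * f (g x)) \<longleftrightarrow> integrable lebesgue f"
    by (simp only: F_def)
  assume f: "integrable lebesgue f"
  have "(\<integral>y. F (?S y) \<partial>lebesgue) = (\<integral>y. f (?S y) \<partial>lebesgue)"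
    using integral_change_of_variables_wellorder[OF derG bijG int(1)[of f, THEN iffD2, OF f]]
    by (simp only: eq)
  then have "(\<integral>x. F x \<partial>lebesgue) = (\<integral>x. f x \<partial>lebesgue)"
    using int(2)[of F] int(2)[of f] by argo
  then show "(\<integral>x. \<bar>det (matrix (g' x))\<bar> * f (g x) \<partial>lebesgue) = (\<integral>x. f x \<partial>lebesgue)"
    by (simp only: F_def)
qed

section \<open>Push-forward densities and their entropy\<close>

text \<open>Preimages under \<phi> are images under its inverse, and a differentiable map of the
  space to itself sends Lebesgue sets to Lebesgue sets. Continuity of \<phi> would only control
  preimages of Borel sets.\<close>

lemma measurable_lebesgue_if_inv_differentiable:
  fixes \<phi> :: "'a :: euclidean_space \<Rightarrow> 'a"
  assumes bij: "bij \<phi>" and diff: "inv \<phi> differentiable_on UNIV"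
  shows "\<phi> \<in> lebesgue \<rightarrow>\<^sub>M lebesgue"
proof (rule measurableI)
  fix A :: "'a set"
  assume "A \<in> sets lebesgue"
  then have "inv \<phi> ` A \<in> sets lebesgue"
    using diff by (intro differentiable_image_in_sets_lebesgue) (auto intro: differentiable_on_subset)
  then show "\<phi> -` A \<inter> space lebesgue \<in> sets lebesgue"
    by (simp add: bij_vimage_eq_inv_image[OF bij])
qed auto

text \<open>The mass of \<open>A\<close> under the push-forward is the integral of \<rho> cut off to
  the preimage of \<open>A\<close>; the substitution by the inverse of \<phi> turns it into the
  integral over \<open>A\<close> of the claimed density.\<close>

lemma distr_density_change_of_variables:
  fixes \<phi> :: "real ^ 'n \<Rightarrow> real ^ 'n" and \<rho> :: "real ^ 'n \<Rightarrow> real"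
  assumes bij: "bij \<phi>"
    and der: "\<And>y. (inv \<phi> has_derivative D y) (at y)"
    and \<rho>: "integrable lebesgue \<rho>" "\<And>x. 0 \<le> \<rho> x"
  shows "distr (density lebesgue \<rho>) lebesgue \<phi> =
    density lebesgue (\<lambda>y. \<bar>det (matrix (D y))\<bar> * \<rho> (inv \<phi> y))"
proof (rule measure_eqI)
  let ?\<sigma> = "\<lambda>y. \<bar>det (matrix (D y))\<bar> * \<rho> (inv \<phi> y)"
  note bij' = bij_imp_bij_inv[OF bij]
  have meas: "\<phi> \<in> lebesgue \<rightarrow>\<^sub>M lebesgue"
    using der by (intro measurable_lebesgue_if_inv_differentiable bij)
      (auto simp: differentiable_on_def differentiable_def intro: has_derivative_at_withinI)
  fix A assume "A \<in> sets (distr (density lebesgue \<rho>) lebesgue \<phi>)"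
  then have A: "A \<in> sets lebesgue" by simp
  have A': "\<phi> -` A \<in> sets lebesgue"
    using measurable_sets[OF meas A] by simp
  let ?f = "\<lambda>x. \<rho> x * indicator (\<phi> -` A) x"
  have f: "integrable lebesgue ?f"
    using integrable_mult_indicator[OF A' \<rho>(1)] by (simp add: mult.commute)
  have eq: "\<bar>det (matrix (D y))\<bar> * ?f (inv \<phi> y) = ?\<sigma> y * indicator A y" for y
    using bij by (simp add: indicator_def bij_is_surj surj_f_inv_f)
  have g: "integrable lebesgue (\<lambda>y. ?\<sigma> y * indicator A y)"
    using integrable_change_of_variables[OF der bij', of ?f] f by (simp only: eq)
  have \<sigma>: "integrable lebesgue ?\<sigma>"
    using integrable_change_of_variables[OF der bij'] \<rho>(1) by blast
  have "emeasure (distr (density lebesgue \<rho>) lebesgue \<phi>) A = emeasure (density lebesgue \<rho>) (\<phi> -` A)"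
    using meas A by (subst emeasure_distr) (auto simp: measurable_density_eq2 measurable_def)
  also have "\<dots> = (\<integral>\<^sup>+x. ennreal (?f x) \<partial>lebesgue)"
    using A' \<rho> by (subst emeasure_density)
      (auto intro!: nn_integral_cong simp: indicator_def)
  \<comment> \<open>The substitution is available for real integrals, so the extended nonnegative
    integral is left here and re-entered after it.\<close>
  also have "\<dots> = ennreal (\<integral>x. ?f x \<partial>lebesgue)"
    using f \<rho>(2) by (intro nn_integral_eq_integral) auto
  also have "(\<integral>x. ?f x \<partial>lebesgue) = (\<integral>y. ?\<sigma> y * indicator A y \<partial>lebesgue)"
    using lebesgue_integral_change_of_variables[OF der bij' f] by (simp only: eq)
  also have "ennreal \<dots> = (\<integral>\<^sup>+y. ennreal (?\<sigma> y * indicator A y) \<partial>lebesgue)"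
    using g \<rho>(2) by (intro nn_integral_eq_integral[symmetric]) auto
  also have "\<dots> = emeasure (density lebesgue ?\<sigma>) A"
    using A \<sigma> by (subst emeasure_density)
      (auto intro!: nn_integral_cong simp: indicator_def)
  finally show "emeasure (distr (density lebesgue \<rho>) lebesgue \<phi>) A = emeasure (density lebesgue ?\<sigma>) A" .
qed simp

lemma borel_measurable_rho_log_rho:
  assumes "\<rho> \<in> borel_measurable lebesgue"
  shows "rho_log_rho \<rho> \<in> borel_measurable lebesgue"
proof -
  have "rho_log_rho \<rho> = (\<lambda>x. \<rho> x * ln (\<rho> x))"
    by (auto simp: rho_log_rho_def)
  then show ?thesis using assms by simp
qed

lemma borel_measurable_pushforward_density:
  "pushforward_density \<phi> \<rho> \<in> borel_measurable lebesgue"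
  unfolding pushforward_density_def[abs_def] by measurable

section \<open>The Jacobian of the inverse and the transformed entropy integrand\<close>

lemma C1_map_has_derivative:
  assumes "C1_map f"
  shows "(f has_derivative (\<lambda>h. jacobian f (at x) *v h)) (at x)"
  using assms by (simp add: C1_map_def flip: jacobian_works)

text \<open>The chain rule for the inverse composed with \<phi> makes the product of the two
  Jacobian matrices the identity.\<close>

lemma det_jacobian_inv:
  fixes \<phi> :: "real ^ 'n \<Rightarrow> real ^ 'n"
  assumes "C1_diffeomorphism \<phi>"
  shows "det (jacobian (inv \<phi>) (at (\<phi> x))) * det (jacobian \<phi> (at x)) = 1"
proof -
  have der: "(\<phi> has_derivative (\<lambda>h. jacobian \<phi> (at x) *v h)) (at x)"
    "(inv \<phi> has_derivative (\<lambda>h. jacobian (inv \<phi>) (at (\<phi> x)) *v h)) (at (\<phi> x))"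
    using assms by (auto simp: C1_diffeomorphism_def intro: C1_map_has_derivative)
  have "inv \<phi> (\<phi> x) = x" for x
    using assms by (simp add: C1_diffeomorphism_def bij_is_inj)
  then have "((\<lambda>x. x) has_derivative
      (\<lambda>h. jacobian (inv \<phi>) (at (\<phi> x)) *v (jacobian \<phi> (at x) *v h))) (at x)"
    using has_derivative_compose[OF der] by simp
  then have "(\<lambda>h. jacobian (inv \<phi>) (at (\<phi> x)) *v (jacobian \<phi> (at x) *v h)) = (\<lambda>h. h)"
    using has_derivative_unique has_derivative_ident by blast
  then have "jacobian (inv \<phi>) (at (\<phi> x)) ** jacobian \<phi> (at x) = mat 1"
    by (metis matrix_eq matrix_vector_mul_assoc matrix_vector_mul_lid)
  then show ?thesis
    by (metis det_I det_mul)
qed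

text \<open>With \<open>x = inv \<phi> y\<close>, the new density is \<rho> at \<open>x\<close>
  divided by the Jacobian determinant there. Its \<open>log\<close> splits, so the new integrand is
  the Jacobian factor of the inverse times \<open>h\<close> at \<open>x\<close>, ready for
  substitution. The difference \<open>h\<close> stays one function because neither of its terms is
  assumed integrable.\<close>

lemma
  fixes \<phi> :: "real ^ 'n \<Rightarrow> real ^ 'n" and \<rho> :: "real ^ 'n \<Rightarrow> real"
  assumes \<phi>: "C1_diffeomorphism \<phi>" and pos: "\<And>x. det (jacobian \<phi> (at x)) > 0"
    and \<rho>: "prob_density \<rho>"
  defines "h \<equiv> \<lambda>x. rho_log_rho \<rho> x - \<rho> x * ln (det (jacobian \<phi> (at x)))"
  shows integrable_rho_log_rho_pushforward:
      "integrable lebesgue (rho_log_rho (pushforward_density \<phi> \<rho>)) \<longleftrightarrow> integrable lebesgue h"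
    and integral_rho_log_rho_pushforward: "integrable lebesgue h \<Longrightarrow>
      integral\<^sup>L lebesgue (rho_log_rho (pushforward_density \<phi> \<rho>)) = integral\<^sup>L lebesgue h"
proof -
  have bij: "bij \<phi>" and C1: "C1_map (inv \<phi>)"
    using \<phi> by (auto simp: C1_diffeomorphism_def)
  note bij' = bij_imp_bij_inv[OF bij]
  define d where "d = (\<lambda>y. det (jacobian (inv \<phi>) (at y)))"
  define \<sigma> where "\<sigma> = (\<lambda>y. \<bar>d y\<bar> * \<rho> (inv \<phi> y))"
  note der = C1_map_has_derivative[OF C1]
  have \<rho>0: "integrable lebesgue \<rho>" "\<And>x. 0 \<le> \<rho> x"
    using \<rho> by (auto simp: prob_density_def)
  have push: "distr (density lebesgue \<rho>) lebesgue \<phi> = density lebesgue \<sigma>"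
    using distr_density_change_of_variables[OF bij der \<rho>0] by (simp add: \<sigma>_def d_def)
  have \<sigma>: "\<sigma> \<in> borel_measurable lebesgue"
    using integrable_change_of_variables[OF der bij', of \<rho>] \<rho>0(1)
    by (simp add: \<sigma>_def d_def borel_measurable_integrable)
  \<comment> \<open>The Radon-Nikodym derivative is replaced by the explicit representative
    \<sigma>; almost everywhere equality suffices for integrals.\<close>
  have AE: "AE y in lebesgue. rho_log_rho (pushforward_density \<phi> \<rho>) y = rho_log_rho \<sigma> y"
    using pushforward_density_unique[OF \<sigma> _ push] \<rho>0(2)
    by (auto simp: \<sigma>_def rho_log_rho_def)
  have d: "d y * det (jacobian \<phi> (at (inv \<phi> y))) = 1" for y
    using det_jacobian_inv[OF \<phi>, of "inv \<phi> y"] bij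
    by (simp add: d_def bij_is_surj surj_f_inv_f)
  have eq: "rho_log_rho \<sigma> y = \<bar>d y\<bar> * h (inv \<phi> y)" for y
  \<comment> \<open>The logarithm of a product splits only for positive factors; where \<rho>
    vanishes, both sides are 0.\<close>
  proof (cases "\<rho> (inv \<phi> y) = 0")
    case True
    then show ?thesis by (simp add: h_def \<sigma>_def rho_log_rho_def)
  next
    case False
    then have \<rho>y: "\<rho> (inv \<phi> y) > 0" using \<rho>0(2)[of "inv \<phi> y"] by linarith
    have dy: "d y = inverse (det (jacobian \<phi> (at (inv \<phi> y))))"
      using d[of y] by (metis inverse_unique mult.commute)
    then have "d y > 0" using pos by simp
    moreover have "ln (d y) = - ln (det (jacobian \<phi> (at (inv \<phi> y))))"
      unfolding dy using pos by (simp add: ln_inverse)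
    ultimately show ?thesis
      using \<rho>y by (simp add: h_def \<sigma>_def rho_log_rho_def ln_mult algebra_simps)
  qed
  note meas = borel_measurable_rho_log_rho[OF borel_measurable_pushforward_density]
    borel_measurable_rho_log_rho[OF \<sigma>]
  have "integrable lebesgue (rho_log_rho (pushforward_density \<phi> \<rho>)) \<longleftrightarrow>
      integrable lebesgue (rho_log_rho \<sigma>)"
    by (rule integrable_cong_AE[OF meas AE])
  also have "rho_log_rho \<sigma> = (\<lambda>y. \<bar>d y\<bar> * h (inv \<phi> y))"
    using eq by blast
  also have "integrable lebesgue \<dots> \<longleftrightarrow> integrable lebesgue h"
    using integrable_change_of_variables[OF der bij'] by (simp add: d_def)
  finally show "integrable lebesgue (rho_log_rho (pushforward_density \<phi> \<rho>)) \<longleftrightarrow>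
      integrable lebesgue h" .
  assume h: "integrable lebesgue h"
  have "integral\<^sup>L lebesgue (rho_log_rho (pushforward_density \<phi> \<rho>)) =
      integral\<^sup>L lebesgue (rho_log_rho \<sigma>)"
    by (rule integral_cong_AE[OF meas AE])
  also have "rho_log_rho \<sigma> = (\<lambda>y. \<bar>d y\<bar> * h (inv \<phi> y))"
    using eq by blast
  also have "integral\<^sup>L lebesgue \<dots> = integral\<^sup>L lebesgue h"
    using lebesgue_integral_change_of_variables[OF der bij' h] by (simp add: d_def)
  finally show "integral\<^sup>L lebesgue (rho_log_rho (pushforward_density \<phi> \<rho>)) =
      integral\<^sup>L lebesgue h" .
qed

section \<open>Uniform densities on balls and the equivalence\<close>

lemma uniform_ball_density:
  fixes a :: "real ^ 'n"
  assumes "r > 0"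
  defines "\<rho> \<equiv> \<lambda>x. indicator (ball a r) x / measure lebesgue (ball a r)"
  shows "prob_density \<rho>" "integrable lebesgue (rho_log_rho \<rho>)"
proof -
  let ?m = "measure lebesgue (ball a r)"
  have m: "?m > 0"
    using assms(1) by (simp add: content_ball_pos)
  have ind: "integrable lebesgue (indicator (ball a r) :: _ \<Rightarrow> real)"
    using lmeasurable_ball[of a r] by (simp add: fmeasurable_def)
  then show "prob_density \<rho>"
    using m by (simp add: prob_density_def \<rho>_def)
  \<comment> \<open>On the ball the density is the constant \<open>1 / ?m\<close>; outside it the
    convention for \<open>0 log 0\<close> gives 0.\<close>
  have "rho_log_rho \<rho> = (\<lambda>x. (ln (1 / ?m) / ?m) * indicator (ball a r) x)"
    by (auto simp: rho_log_rho_def \<rho>_def indicator_def)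
  then show "integrable lebesgue (rho_log_rho \<rho>)"
    using ind by simp
qed

theorem proposition3:
  fixes \<phi> :: "real ^ 'n \<Rightarrow> real ^ 'n"
  assumes "C1_diffeomorphism \<phi>"
    and "\<And>x. det (jacobian \<phi> (at x)) > 0"
  shows "(\<forall>\<rho>. prob_density \<rho> \<and> integrable lebesgue (rho_log_rho \<rho>) \<longrightarrow>
            integrable lebesgue (rho_log_rho (pushforward_density \<phi> \<rho>)) \<and>
            info_entropy (pushforward_density \<phi> \<rho>) = info_entropy \<rho>)
         \<longleftrightarrow> (\<forall>x. det (jacobian \<phi> (at x)) = 1)"
proof
  assume "\<forall>x. det (jacobian \<phi> (at x)) = 1"
  then show "\<forall>\<rho>. prob_density \<rho> \<and> integrable lebesgue (rho_log_rho \<rho>) \<longrightarrow>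
      integrable lebesgue (rho_log_rho (pushforward_density \<phi> \<rho>)) \<and>
      info_entropy (pushforward_density \<phi> \<rho>) = info_entropy \<rho>"
    using integrable_rho_log_rho_pushforward[OF assms] integral_rho_log_rho_pushforward[OF assms]
    by (simp add: info_entropy_def)
next
  assume inv: "\<forall>\<rho>. prob_density \<rho> \<and> integrable lebesgue (rho_log_rho \<rho>) \<longrightarrow>
      integrable lebesgue (rho_log_rho (pushforward_density \<phi> \<rho>)) \<and>
      info_entropy (pushforward_density \<phi> \<rho>) = info_entropy \<rho>"
  define l where "l = (\<lambda>x. ln (det (jacobian \<phi> (at x))))"
  have cont: "continuous_on UNIV l"
  proof -
    have "continuous_on UNIV (\<lambda>x. jacobian \<phi> (at x))"
      using assms(1) by (simp add: C1_diffeomorphism_def C1_map_def)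
    \<comment> \<open>Expanded over permutations, the determinant is a polynomial in the continuous
      matrix entries; positivity keeps its logarithm continuous.\<close>
    then show ?thesis
      unfolding l_def det_def using assms(2)[unfolded det_def]
      by (intro continuous_intros) (auto simp: less_imp_neq[symmetric])
  qed
  have "l a = 0" for a
  proof (rule ccontr)
    assume la: "l a \<noteq> 0"
    \<comment> \<open>Multiplying by \<open>l a\<close> treats both signs at once: the set is where
      \<open>l\<close> has the sign it has at \<open>a\<close>.\<close>
    have "open {x. 0 < l x * l a}"
      using cont by (intro open_Collect_less continuous_intros)
    moreover have "a \<in> {x. 0 < l x * l a}"
      using la by (simp add: zero_less_mult_iff) linarith
    ultimately obtain r where "r > 0" "ball a r \<subseteq> {x. 0 < l x * l a}"
      using openE by blast
    then have r: "r > 0" "\<And>x. x \<in> ball a r \<Longrightarrow> 0 < l x * l a"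
      by auto
    let ?m = "measure lebesgue (ball a r)"
    have m: "?m > 0"
      using r(1) by (simp add: content_ball_pos)
    define \<rho> :: "real ^ 'n \<Rightarrow> real" where "\<rho> = (\<lambda>x. indicator (ball a r) x / ?m)"
    note \<rho> = uniform_ball_density[OF r(1), of a, folded \<rho>_def]
    \<comment> \<open>The assumed integrability for the push-forward passes to this difference, so
      the equality of entropies below concerns genuine integrals and not default values.\<close>
    have int: "integrable lebesgue (\<lambda>x. rho_log_rho \<rho> x - \<rho> x * l x)"
      using inv \<rho> integrable_rho_log_rho_pushforward[OF assms \<rho>(1)] by (simp add: l_def)
    have "(\<integral>x. rho_log_rho \<rho> x - \<rho> x * l x \<partial>lebesgue) = integral\<^sup>L lebesgue (rho_log_rho \<rho>)"
      using inv \<rho> integral_rho_log_rho_pushforward[OF assms \<rho>(1)] int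
      by (simp add: l_def info_entropy_def)
    moreover have g: "integrable lebesgue (\<lambda>x. \<rho> x * l x)"
      using Bochner_Integration.integrable_diff[OF \<rho>(2) int] by simp
    ultimately have "(\<integral>x. \<rho> x * l x \<partial>lebesgue) = 0"
      using \<rho>(2) by simp
    \<comment> \<open>The factor \<open>l a\<close> makes the integrand nonnegative everywhere and
      positive on the ball. Its zero integral would force the ball to be a null set.\<close>
    then have "(\<integral>x. \<rho> x * l x * l a \<partial>lebesgue) = 0"
      by simp
    moreover have nonneg: "0 \<le> \<rho> x * l x * l a" for x
      using r(2)[of x] m by (auto simp: \<rho>_def indicator_def mult.assoc)
    ultimately have "AE x in lebesgue. \<rho> x * l x * l a = 0"
      using integral_nonneg_eq_0_iff_AE[of lebesgue "\<lambda>x. \<rho> x * l x * l a"] g by simp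
    then have "AE x in lebesgue. x \<notin> ball a r"
      by eventually_elim (use r(2) m in \<open>force simp: \<rho>_def indicator_def\<close>)
    then have "ball a r \<in> null_sets lebesgue"
      by (subst completion.null_sets_iff_AE) auto
    then show False
      using m by (simp add: measure_def null_sets_def)
  qed
  \<comment> \<open>Positivity matters here, since \<open>ln\<close> is also 0 at 0.\<close>
  then show "\<forall>x. det (jacobian \<phi> (at x)) = 1"
    using assms(2) by (auto simp: l_def)
qed

end
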